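(* For $n\ge 0$ let $a(n)$ be the number of permutations $\pi$ of $\{1,\dots,n\}$ such that $\pi_{i+1}-\pi_i\neq 1$ for all $1\le i\le n-1$ (with $a(0)=1$). Then for all $n\ge 2$, $$a(n)=(n-1)\,a(n-1)+(n-2)\,a(n-2).$$
   Context: A permutation $\pi$ of $\{1,\dots,n\}$ is written $\pi_1\pi_2\cdots\pi_n$. The empty permutation is the unique permutation of length $0$. *)

theory Defs
  imports "HOL-Combinatorics.Permutations"
begin

definition succession_free :: "nat \<Rightarrow> (nat \<Rightarrow> nat) set" where
  "succession_free n =
     {\<pi>. \<pi> permutes {1..n} \<and> (\<forall>i\<in>{1..n - 1}. int (\<pi> (i + 1)) - int (\<pi> i) \<noteq> 1)}"

definition a :: "nat \<Rightarrow> nat" where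
  "a n = card (succession_free n)"

(* The only permutation of the empty set is the identity, which is the empty permutation here. *)
lemma a_0: "a 0 = 1"
  by (simp add: a_def succession_free_def)

end

theory Submission
  imports Defs "HOL-Combinatorics.Multiset_Permutations" "HOL-Library.Sublist"
begin

text \<open>
  Write permutations as words and, on an arbitrary finite set \<open>A\<close> of letters, forbid only
  the first \<open>k\<close> successions, those from \<open>j\<close> to \<open>j + 1\<close> with \<open>1 \<le> j \<le> k\<close>. Among the
  words that avoid the first \<open>k\<close> successions, those that contain the next one, from \<open>k + 1\<close>
  to \<open>k + 2\<close>, correspond to the words on \<open>A - {k + 2}\<close> that avoid the first \<open>k\<close>: simply
  erase the letter \<open>k + 2\<close>. So one more forbidden succession amounts to one subtraction
  (\<open>card_avoiding_Suc\<close>). With nothing forbidden the count is a factorial, hence in general it is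
  an iterated forward difference of the factorial, an entry of Euler's difference table
  (\<open>card_avoiding\<close>), and \<open>a n\<close> is the \<open>(n - 1)\<close>-st difference at \<open>1\<close>.

  The claim is then a three-term recurrence for these differences
  (\<open>fact_diff_recurrence\<close>). It reflects integration by parts in
  \<open>\<Delta>\<^sup>k r! = \<integral>\<^sub>0\<^sup>\<infinity> x\<^sup>r (x - 1)\<^sup>k e\<^sup>-\<^sup>x dx\<close>, but induction on \<open>k\<close> proves it directly.
  Allowing an arbitrary letter set is what makes the erasure work without relabelling.
\<close>

section \<open>Iterated differences of the factorial\<close>

fun fact_diff :: "nat \<Rightarrow> nat \<Rightarrow> int" where
  "fact_diff 0 r = fact r"
| "fact_diff (Suc k) r = fact_diff k (Suc r) - fact_diff k r"

text \<open>
  The recurrence is stable under taking differences in \<open>r\<close>. By the product rule, the difference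
  of \<open>(r + k + 1) \<cdot> fact_diff (k + 1) r\<close> is \<open>(r + k + 2) \<cdot> fact_diff (k + 2) r\<close> plus one extra
  \<open>fact_diff (k + 1) r\<close>, and that extra term raises the last coefficient \<open>k + 1\<close> to \<open>k + 2\<close>.
\<close>

lemma fact_diff_recurrence:
  "fact_diff (Suc (Suc k)) r =
     int (r + k + 1) * fact_diff (Suc k) r + int (k + 1) * fact_diff k r"
proof (induction k arbitrary: r)
  case 0
  show ?case by (simp add: algebra_simps)
next
  case (Suc k)
  define u v where "u = fact_diff (Suc k) r" and "v = fact_diff k r"
  define u' where "u' = fact_diff (Suc k) (Suc r)"
  have v': "fact_diff k (Suc r) = u + v"
    by (simp add: u_def v_def)
  have lower: "fact_diff (Suc (Suc k)) r = u' - u"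
    by (simp add: u_def u'_def)
  have IH: "u' - u = int (r + k + 1) * u + int (k + 1) * v"
    using Suc.IH[of r] unfolding lower u_def v_def .
  have IH': "fact_diff (Suc (Suc k)) (Suc r) = int (r + k + 2) * u' + int (k + 1) * (u + v)"
    using Suc.IH[of "Suc r"] unfolding v' u'_def by simp
  have "fact_diff (Suc (Suc (Suc k))) r = fact_diff (Suc (Suc k)) (Suc r) - fact_diff (Suc (Suc k)) r"
    by (rule fact_diff.simps(2))
  also have "\<dots> = int (r + k + 2) * u' + int (k + 1) * (u + v) - (u' - u)"
    unfolding IH' lower ..
  also have "\<dots> = int (r + k + 2) * (u' - u) + int (k + 2) * u"
    using IH by (simp add: algebra_simps)
  finally show ?case
    unfolding lower u_def[symmetric] by (simp del: fact_diff.simps)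
qed

section \<open>Words avoiding the first successions\<close>

definition avoiding :: "nat set \<Rightarrow> nat \<Rightarrow> nat list set" where
  "avoiding A k =
     {xs \<in> permutations_of_set A. \<forall>j\<in>{1..k}. \<not> sublist [j, Suc j] xs}"

lemma sublist_pair_append_Cons:
  "sublist [x, y] (us @ z # vs) \<longleftrightarrow> sublist [x, y] (us @ [z]) \<or> sublist [x, y] (z # vs)"
proof (induction us)
  case Nil
  show ?case by (auto simp: sublist_Cons_right)
next
  case (Cons u us)
  then show ?case by (cases us) (auto simp: sublist_Cons_right)
qed

lemma sublist_pair_iff_nth:
  "sublist [x, y] xs \<longleftrightarrow> (\<exists>i. Suc i < length xs \<and> xs ! i = x \<and> xs ! Suc i = y)"
proof
  assume "sublist [x, y] xs"
  then obtain us vs where "xs = us @ [x, y] @ vs"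
    by (auto simp: sublist_def)
  then show "\<exists>i. Suc i < length xs \<and> xs ! i = x \<and> xs ! Suc i = y"
    by (intro exI[of _ "length us"]) (auto simp: nth_append)
next
  assume "\<exists>i. Suc i < length xs \<and> xs ! i = x \<and> xs ! Suc i = y"
  then obtain i where i: "Suc i < length xs" "xs ! i = x" "xs ! Suc i = y"
    by blast
  then have "xs = take i xs @ [x, y] @ drop (Suc (Suc i)) xs"
    by (metis Cons_nth_drop_Suc Suc_lessD append_Cons append_Nil append_take_drop_id)
  then show "sublist [x, y] xs"
    unfolding sublist_def by blast
qed

text \<open>
  A forbidden succession \<open>j, j + 1\<close> with \<open>j \<le> k\<close> starts neither at \<open>k + 1\<close> nor at \<open>k + 2\<close>.
  So the letter after either of them is unconstrained, and erasing \<open>k + 2\<close> behind \<open>k + 1\<close>, or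
  inserting it there, neither creates nor destroys a forbidden succession.
\<close>

lemma avoiding_insert_iff:
  assumes "Suc (Suc k) \<in> A"
  shows "us @ [Suc k, Suc (Suc k)] @ vs \<in> avoiding A k \<longleftrightarrow>
           us @ [Suc k] @ vs \<in> avoiding (A - {Suc (Suc k)}) k \<and> Suc (Suc k) \<notin> set (us @ vs)"
proof -
  have "sublist [j, Suc j] (us @ [Suc k, Suc (Suc k)] @ vs) \<longleftrightarrow>
          sublist [j, Suc j] (us @ [Suc k] @ vs)" if "j \<in> {1..k}" for j
    using that sublist_pair_append_Cons[of j "Suc j" us "Suc k" vs]
      sublist_pair_append_Cons[of j "Suc j" us "Suc k" "Suc (Suc k) # vs"]
    by (auto simp: sublist_Cons_right)
  moreover have "us @ [Suc k, Suc (Suc k)] @ vs \<in> permutations_of_set A \<longleftrightarrow>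
      us @ [Suc k] @ vs \<in> permutations_of_set (A - {Suc (Suc k)}) \<and> Suc (Suc k) \<notin> set (us @ vs)"
    using assms by (auto simp: permutations_of_set_def)
  ultimately show ?thesis
    by (auto simp: avoiding_def)
qed

lemma card_avoiding_with_next:
  assumes "Suc k \<in> A" "Suc (Suc k) \<in> A"
  shows "card {xs \<in> avoiding A k. sublist [Suc k, Suc (Suc k)] xs} =
           card (avoiding (A - {Suc (Suc k)}) k)"
    (is "card ?S = card ?T")
proof -
  let ?f = "remove1 (Suc (Suc k))"
  have split: "\<exists>us vs. xs = us @ [Suc k, Suc (Suc k)] @ vs \<and> ?f xs = us @ [Suc k] @ vs \<and>
                 Suc k \<notin> set us \<and> Suc k \<notin> set vs" if "xs \<in> ?S" for xs
  proof -
    from that obtain us vs where xs: "xs = us @ [Suc k, Suc (Suc k)] @ vs"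
      by (auto simp: sublist_def)
    moreover have "distinct xs"
      using that by (auto simp: avoiding_def permutations_of_set_def)
    ultimately show ?thesis
      by (intro exI[of _ us] exI[of _ vs]) (auto simp: remove1_append)
  qed
  have "inj_on ?f ?S"
  proof (rule inj_onI)
    fix xs ys assume "xs \<in> ?S" "ys \<in> ?S" and eq: "?f xs = ?f ys"
    then show "xs = ys"
      using split[of xs] split[of ys] by (auto simp: append_Cons_eq_iff)
  qed
  moreover have "?f ` ?S = ?T"
  proof (intro equalityI subsetI)
    fix ys assume "ys \<in> ?f ` ?S"
    then obtain xs where xs: "xs \<in> ?S" "ys = ?f xs" by blast
    then show "ys \<in> ?T"
      using split[of xs] avoiding_insert_iff[OF assms(2)] by auto
  next
    fix ys assume ys: "ys \<in> ?T"
    then have set_ys: "set ys = A - {Suc (Suc k)}"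
      by (auto simp: avoiding_def permutations_of_set_def)
    then have "Suc k \<in> set ys"
      using assms by auto
    then obtain us vs where eq: "ys = us @ [Suc k] @ vs"
      by (auto simp: in_set_conv_decomp)
    then have notin: "Suc (Suc k) \<notin> set (us @ vs)"
      using set_ys by auto
    let ?xs = "us @ [Suc k, Suc (Suc k)] @ vs"
    have "?xs \<in> ?S"
      using ys eq notin avoiding_insert_iff[OF assms(2), of us vs]
      by (auto simp: sublist_def)
    moreover have "?f ?xs = ys"
      using eq notin by (simp add: remove1_append)
    ultimately show "ys \<in> ?f ` ?S"
      by (metis (no_types, lifting) image_eqI)
  qed
  ultimately show ?thesis
    by (metis card_image)
qed

lemma card_avoiding_Suc:
  assumes "Suc k \<in> A" "Suc (Suc k) \<in> A"
  shows "int (card (avoiding A (Suc k))) =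
           int (card (avoiding A k)) - int (card (avoiding (A - {Suc (Suc k)}) k))"
proof -
  let ?S = "{xs \<in> avoiding A k. sublist [Suc k, Suc (Suc k)] xs}"
  have fin: "finite (avoiding A k)"
    by (simp add: avoiding_def)
  have "card (avoiding A k) = card (avoiding A (Suc k) \<union> ?S)"
    by (rule arg_cong[where f = card]) (auto simp: avoiding_def atLeastAtMostSuc_conv)
  also have "\<dots> = card (avoiding A (Suc k)) + card ?S"
  proof (rule card_Un_disjoint)
    show "finite ?S"
      using fin by simp
  qed (auto simp: avoiding_def)
  finally show ?thesis
    using card_avoiding_with_next[OF assms] by simp
qed

text \<open>
  The letters up to \<open>k + 1\<close> must be present for the \<open>k\<close> successions to be real constraints;
  \<open>r\<close> is the number of blocks that remain when these \<open>k\<close> successions are glued together.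
\<close>

lemma card_avoiding:
  assumes "finite A" "{1..Suc k} \<subseteq> A" "card A = r + k"
  shows "int (card (avoiding A k)) = fact_diff k r"
  using assms
proof (induction k arbitrary: A r)
  case 0
  then show ?case by (simp add: avoiding_def)
next
  case (Suc k)
  have mem: "Suc k \<in> A" "Suc (Suc k) \<in> A"
    using Suc.prems(2) by auto
  have "int (card (avoiding A k)) = fact_diff k (Suc r)"
    using Suc.prems by (intro Suc.IH) auto
  moreover have "int (card (avoiding (A - {Suc (Suc k)}) k)) = fact_diff k r"
    using Suc.prems mem by (intro Suc.IH) auto
  ultimately show ?case
    using card_avoiding_Suc[OF mem] by simp
qed

section \<open>From functions to words\<close>

lemma bij_betw_permutes_words:
  "bij_betw (\<lambda>\<pi>. map \<pi> [1..<Suc n]) {\<pi>. \<pi> permutes {1..n}} (permutations_of_set {1..n})"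
proof -
  let ?w = "\<lambda>\<pi>. map \<pi> [1..<Suc n]"
  have inj: "inj_on ?w {\<pi>. \<pi> permutes {1..n}}"
  proof (rule inj_onI)
    fix \<pi> \<sigma> :: "nat \<Rightarrow> nat"
    assume "\<pi> \<in> {\<pi>. \<pi> permutes {1..n}}" "\<sigma> \<in> {\<pi>. \<pi> permutes {1..n}}"
      and w: "?w \<pi> = ?w \<sigma>"
    then have outside: "\<pi> i = i" "\<sigma> i = i" if "i \<notin> {1..n}" for i
      using that permutes_not_in by (metis mem_Collect_eq)+
    have inside: "\<pi> i = \<sigma> i" if "i \<in> {1..n}" for i
      using w that unfolding map_eq_conv by (metis atLeastAtMost_upt)
    show "\<pi> = \<sigma>"
      using inside outside by (metis ext)
  qed
  have sub: "?w ` {\<pi>. \<pi> permutes {1..n}} \<subseteq> permutations_of_set {1..n}"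
  proof (intro image_subsetI)
    fix \<pi> :: "nat \<Rightarrow> nat" assume "\<pi> \<in> {\<pi>. \<pi> permutes {1..n}}"
    then have p: "\<pi> permutes {1..n}" by simp
    then show "?w \<pi> \<in> permutations_of_set {1..n}"
      unfolding permutations_of_set_def mem_Collect_eq set_map distinct_map
        atLeastAtMost_upt[symmetric]
      using permutes_image[OF p] permutes_inj_on[OF p] by (intro conjI distinct_upt)
  qed
  \<comment> \<open>Surjectivity by counting: both sides have \<open>n!\<close> elements.\<close>
  have "card (?w ` {\<pi>. \<pi> permutes {1..n}}) = card (permutations_of_set {1..n})"
    unfolding card_image[OF inj] by (simp add: card_permutations)
  with sub have "?w ` {\<pi>. \<pi> permutes {1..n}} = permutations_of_set {1..n}"
    by (intro card_subset_eq) simp_all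
  with inj show ?thesis
    unfolding bij_betw_def ..
qed

lemma word_avoiding_iff:
  assumes "\<pi> permutes {1..n}"
  shows "map \<pi> [1..<Suc n] \<in> avoiding {1..n} (n - 1) \<longleftrightarrow> \<pi> \<in> succession_free n"
proof -
  have range: "\<pi> i \<in> {1..n} \<longleftrightarrow> i \<in> {1..n}" for i
    by (rule permutes_in_image[OF assms])
  have pair: "sublist [j, Suc j] (map \<pi> [1..<Suc n]) \<longleftrightarrow>
      (\<exists>i\<in>{1..n - 1}. \<pi> i = j \<and> \<pi> (i + 1) = Suc j)" for j
  proof
    assume "sublist [j, Suc j] (map \<pi> [1..<Suc n])"
    then obtain i where "Suc i < n" "\<pi> (Suc i) = j" "\<pi> (Suc (Suc i)) = Suc j"
      by (auto simp: sublist_pair_iff_nth simp del: upt_Suc)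
    then show "\<exists>i\<in>{1..n - 1}. \<pi> i = j \<and> \<pi> (i + 1) = Suc j"
      by (intro bexI[of _ "Suc i"]) auto
  next
    assume "\<exists>i\<in>{1..n - 1}. \<pi> i = j \<and> \<pi> (i + 1) = Suc j"
    then obtain i where "i \<in> {1..n - 1}" "\<pi> i = j" "\<pi> (i + 1) = Suc j" by blast
    then show "sublist [j, Suc j] (map \<pi> [1..<Suc n])"
      unfolding sublist_pair_iff_nth
      by (intro exI[of _ "i - 1"]) (auto simp del: upt_Suc)
  qed
  have "map \<pi> [1..<Suc n] \<in> permutations_of_set {1..n}"
    using bij_betwE[OF bij_betw_permutes_words] assms by blast
  moreover have "(\<forall>j\<in>{1..n - 1}. \<not> (\<exists>i\<in>{1..n - 1}. \<pi> i = j \<and> \<pi> (i + 1) = Suc j)) \<longleftrightarrow>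
      (\<forall>i\<in>{1..n - 1}. int (\<pi> (i + 1)) - int (\<pi> i) \<noteq> 1)"
  proof -
    \<comment> \<open>A letter that has its successor in the word is automatically at most \<open>n - 1\<close>.\<close>
    have "\<pi> i \<in> {1..n - 1}" if "i \<in> {1..n - 1}" "\<pi> (i + 1) = Suc (\<pi> i)" for i
      using that range[of i] range[of "i + 1"] by auto
    moreover have "int (\<pi> (i + 1)) - int (\<pi> i) = 1 \<longleftrightarrow> \<pi> (i + 1) = Suc (\<pi> i)" for i
      by linarith
    ultimately show ?thesis
      by metis
  qed
  ultimately show ?thesis
    using assms unfolding avoiding_def succession_free_def pair mem_Collect_eq
    by (simp del: upt_Suc)
qed

lemma a_eq_card_avoiding: "a n = card (avoiding {1..n} (n - 1))"
proof -
  let ?w = "\<lambda>\<pi>. map \<pi> [1..<Suc n]"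
  have "bij_betw ?w (succession_free n) (avoiding {1..n} (n - 1))"
  proof (rule bij_betw_subset[OF bij_betw_permutes_words[of n]])
    show "succession_free n \<subseteq> {\<pi>. \<pi> permutes {1..n}}"
      by (auto simp: succession_free_def)
    have "avoiding {1..n} (n - 1) \<subseteq> ?w ` {\<pi>. \<pi> permutes {1..n}}"
      using bij_betw_permutes_words[of n] by (auto simp: bij_betw_def avoiding_def)
    then show "?w ` succession_free n = avoiding {1..n} (n - 1)"
      using word_avoiding_iff[of _ n] by (fastforce simp: succession_free_def simp del: upt_Suc)
  qed
  then show ?thesis
    unfolding a_def by (rule bij_betw_same_card)
qed

lemma a_Suc: "int (a (Suc k)) = fact_diff k 1"
  unfolding a_eq_card_avoiding diff_Suc_1 by (rule card_avoiding) auto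

theorem proposition1:
  fixes n :: nat
  assumes "n \<ge> 2"
  shows "a n = (n - 1) * a (n - 1) + (n - 2) * a (n - 2)"
proof (cases "n = 2")
  case True
  \<comment> \<open>Here \<open>a 0\<close> has coefficient zero; it is not an entry \<open>fact_diff k 1\<close>.\<close>
  have "int (a 2) = 1" "int (a 1) = 1"
    using a_Suc[of 0] a_Suc[of 1] by (simp_all add: numeral_2_eq_2)
  then show ?thesis
    using True by simp
next
  case False
  with assms obtain k where n: "n = Suc (Suc (Suc k))"
    by (metis Suc_1 add_2_eq_Suc le_Suc_ex not0_implies_Suc add.right_neutral)
  have "int (a n) = int ((n - 1) * a (n - 1) + (n - 2) * a (n - 2))"
    using fact_diff_recurrence[of k 1]
    unfolding n by (simp add: a_Suc algebra_simps del: fact_diff.simps)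
  then show ?thesis
    by (simp only: of_nat_eq_iff)
qed

end
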